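(* Let $s\in\mathbb{N}$, let $\mathbb{A}=\mathbb{F}\oplus\left(\bigoplus_{n=0}^s\mathbb{A}_n\right)$ and $\mathbb{B}=\bigoplus_{n=0}^s\mathbb{B}_n$ be two graded spaces, and let $\mathcal{T}\colon\mathbb{A}\to\mathbb{B}$ be a nonlinear operator. Suppose that $\mathcal{T}$ can be decomposed as the sum of two operators $\mathcal{T}=\mathcal{T}_*+\mathcal{R}$ such that: (1a) $\mathcal{T}_*\colon\mathbb{A}\to\mathbb{B}$ is linear; (1b) for all $n\in\{0,\dots,s\}$, $\mathcal{T}_*(\mathbb{A}_n)\subseteq\mathbb{B}_n$; (1c) $\mathcal{T}_*$ is surjective; (2a) $\mathcal{R}\colon\mathbb{A}\to\mathbb{B}$ is nonlinear; (2b) for all $n\in\{0,\dots,s-1\}$, $\mathcal{R}\left(\bigoplus_{k=n}^s\mathbb{A}_k\right)\subseteq\bigoplus_{k=n+1}^s\mathbb{B}_k$; (2c) $\mathcal{R}(\mathbb{A}_s)=\{0_{\mathbb{B}}\}$. Additionally, assume that: (i) $\mathcal{T}_*(\mathbb{F})=\{0_{\mathbb{B}}\}$; (ii) for all $n\in\{0,\dots,s\}$, $\mathbb{A}_n=\mathbb{U}_n\oplus\mathbb{V}_n$ and $\mathcal{T}_*|_{\mathbb{V}_n}\colon\mathbb{V}_n\to\mathbb{B}_n$ is invertible; (iii) for all $n\in\{0,\dots,s\}$, $\mathcal{S}_n\colon\mathbb{B}_n\to\mathbb{A}_n$ is the (linear) right inverse of $\mathcal{T}_*|_{\mathbb{A}_n}$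 defined by $\mathcal{S}_n=[\mathcal{T}_*|_{\mathbb{V}_n}]^{-1}$; (iv) for all $x\in\mathbb{A}$, written $x=z+\sum_{k=0}^s x_k$ with $z\in\mathbb{F}$ and $x_k\in\mathbb{A}_k$ for all $k\in\{0,\dots,s\}$, one has $\mathcal{P}_{\mathbb{B}_0}[\mathcal{R}(x)]=\mathcal{P}_{\mathbb{B}_0}[\mathcal{R}(z)]$ and, for all $n\in\{1,\dots,s\}$, $$\mathcal{P}_{\mathbb{B}_n}[\mathcal{R}(x)]=\mathcal{P}_{\mathbb{B}_n}\left[\mathcal{R}\left(z+\sum_{k=0}^{n-1}x_k\right)\right].$$ Let $y=\sum_{k=0}^s y_k\in\mathbb{B}$ with $y_k\in\mathbb{B}_k$. Then for every $z\in\mathbb{F}$ and every $u=\sum_{k=0}^s u_k\in\bigoplus_{k=0}^s\mathbb{U}_k$ (with $u_k\in\mathbb{U}_k$), the element $x=z+\sum_{k=0}^s x_k\in\mathbb{A}$ whose components are computed successively by $$x_0=u_0+\mathcal{S}_0\left(y_0-\mathcal{P}_{\mathbb{B}_0}[\mathcal{R}(z)]-\mathcal{T}_*(u_0)\right),$$ $$x_k=u_k+\mathcal{S}_k\left(y_k-\mathcal{P}_{\mathbb{B}_k}\left[\mathcal{R}\left(z+\sum_{l=0}^{k-1}x_l\right)\right]-\mathcal{T}_*(u_k)\right)\quad\text{for } k=1,\dots,s,$$ satisfies $\mathcal{T}(x)=y$.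
   Context: $\mathbb{N}$ denotes the set of positive integers. A graded space here is a vector space given as a finite direct sum of vector spaces (its layers); $\mathbb{F}$, $\mathbb{A}_n$, $\mathbb{B}_n$ are vector spaces over a common field, and $\mathbb{U}_n$, $\mathbb{V}_n$ are linear subspaces of $\mathbb{A}_n$. Each $y\in\mathbb{B}=\bigoplus_{n=0}^s\mathbb{B}_n$ is uniquely written $y=\sum_{n=0}^s y_n$ with $y_n\in\mathbb{B}_n$, and the projection operator $\mathcal{P}_{\mathbb{B}_n}\colon\mathbb{B}\to\mathbb{B}_n$ is $y\mapsto y_n$. *)

theory Defs
  imports Complex_Main "HOL-Library.FuncSet" "HOL-Library.Set_Algebras"
begin

text \<open>
  Graded spaces are treated as internal direct sums of linear subspaces. Sums of sets, both
  \<open>U + V\<close> and \<open>\<Sum>i\<in>I. W i\<close>, are the elementwise ones of \<^theory>\<open>HOL-Library.Set_Algebras\<close>.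
\<close>

context vector_space
begin

definition direct_sum2 :: "'b set \<Rightarrow> 'b set \<Rightarrow> 'b set \<Rightarrow> bool" where
  "direct_sum2 X U V \<longleftrightarrow>
     subspace U \<and> subspace V \<and> X = U + V \<and>
     (\<forall>x\<in>X. \<exists>!p. p \<in> U \<times> V \<and> x = fst p + snd p)"

definition direct_sum :: "'b set \<Rightarrow> 'i set \<Rightarrow> ('i \<Rightarrow> 'b set) \<Rightarrow> bool" where
  "direct_sum X I W \<longleftrightarrow>
     finite I \<and> (\<forall>i\<in>I. subspace (W i)) \<and> X = (\<Sum>i\<in>I. W i) \<and>
     (\<forall>x\<in>X. \<exists>!w. w \<in> Pi\<^sub>E I W \<and> x = (\<Sum>i\<in>I. w i))"

end

text \<open>The \<open>n\<close>-th component of \<open>y\<close>; meaningful when \<open>y\<close> lies in the direct sum of the \<open>W i\<close>.\<close>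

definition layer_proj :: "'i set \<Rightarrow> ('i \<Rightarrow> 'b::ab_group_add set) \<Rightarrow> 'i \<Rightarrow> 'b \<Rightarrow> 'b" where
  "layer_proj I W n y = (THE w. w \<in> Pi\<^sub>E I W \<and> y = (\<Sum>i\<in>I. w i)) n"

end

theory Submission
  imports Defs
begin

text \<open>
  By construction \<open>Tstar (xc k) = yc k - P\<^sub>k (R x)\<close>, where \<open>P\<^sub>k\<close> is the projection onto \<open>B k\<close>:
  the recursion sees only the partial sum below layer \<open>k\<close>, but (iv) says that this already
  determines the \<open>k\<close>-th layer of \<open>R x\<close>. Summing over the layers gives \<open>Tstar x = y - R x\<close>.
\<close>

context vector_space
begin

text \<open>\<open>layer_proj\<close> is a definite description; uniqueness of the decomposition in
  \<open>direct_sum\<close> makes it denote the actual family of components. These two facts replace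
  its definition from here on.\<close>

lemma direct_sum_layer_proj:
  assumes "direct_sum X I W" and "x \<in> X"
  shows "\<And>i. i \<in> I \<Longrightarrow> layer_proj I W i x \<in> W i"
    and "(\<Sum>i\<in>I. layer_proj I W i x) = x"
proof -
  have "\<exists>!w. w \<in> Pi\<^sub>E I W \<and> x = (\<Sum>i\<in>I. w i)"
    using assms unfolding direct_sum_def by blast
  from theI'[OF this]
  show "\<And>i. i \<in> I \<Longrightarrow> layer_proj I W i x \<in> W i"
    and "(\<Sum>i\<in>I. layer_proj I W i x) = x"
    unfolding layer_proj_def by (auto simp: PiE_def)
qed

lemma direct_sum_subspace: "direct_sum X I W \<Longrightarrow> i \<in> I \<Longrightarrow> subspace (W i)"
  by (simp add: direct_sum_def)

lemma direct_sum2_add_mem: "direct_sum2 X U V \<Longrightarrow> u \<in> U \<Longrightarrow> v \<in> V \<Longrightarrow> u + v \<in> X"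
  by (auto simp: direct_sum2_def set_plus_intro)

lemma direct_sum2_left_mem: "direct_sum2 X U V \<Longrightarrow> u \<in> U \<Longrightarrow> u \<in> X"
  using direct_sum2_add_mem[of X U V u 0] by (simp add: direct_sum2_def subspace_0)

end

theorem theorem2:
  fixes scaleA :: "'k::field \<Rightarrow> 'a::ab_group_add \<Rightarrow> 'a"
    and scaleB :: "'k \<Rightarrow> 'b::ab_group_add \<Rightarrow> 'b"
    and s :: nat
    and F :: "'a set" and A U V :: "nat \<Rightarrow> 'a set" and B :: "nat \<Rightarrow> 'b set"
    and T Tstar R :: "'a \<Rightarrow> 'b" and S :: "nat \<Rightarrow> 'b \<Rightarrow> 'a"
    and y :: 'b and yc :: "nat \<Rightarrow> 'b"
    and z u :: 'a and uc xc :: "nat \<Rightarrow> 'a"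
  assumes "vector_space scaleA" and "vector_space scaleB"
    and "s \<ge> 1"
    and "vector_space.direct_sum scaleA (\<Sum>n=0..s. A n) {0..s} A"
    and "vector_space.direct_sum2 scaleA UNIV F (\<Sum>n=0..s. A n)"
    and "vector_space.direct_sum scaleB UNIV {0..s} B"
    and decomposition: "\<forall>x. T x = Tstar x + R x"
    and h1a: "Vector_Spaces.linear scaleA scaleB Tstar"
    and h1b: "\<forall>n\<in>{0..s}. Tstar ` A n \<subseteq> B n"
    and h1c: "surj Tstar"
    and h2b: "\<forall>n\<in>{0..s-1}. R ` (\<Sum>k=n..s. A k) \<subseteq> (\<Sum>k=n+1..s. B k)"
    and h2c: "R ` A s = {0}"
    and hi: "Tstar ` F = {0}"
    and hii: "\<forall>n\<in>{0..s}. vector_space.direct_sum2 scaleA (A n) (U n) (V n)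
                          \<and> bij_betw Tstar (V n) (B n)"
    and hiii: "\<forall>n\<in>{0..s}. \<forall>b\<in>B n. S n b = the_inv_into (V n) Tstar b"
    and hiv: "\<forall>z\<in>F. \<forall>x. (\<forall>k\<in>{0..s}. x k \<in> A k) \<longrightarrow>
                layer_proj {0..s} B 0 (R (z + (\<Sum>k=0..s. x k))) = layer_proj {0..s} B 0 (R z) \<and>
                (\<forall>n\<in>{1..s}. layer_proj {0..s} B n (R (z + (\<Sum>k=0..s. x k))) =
                             layer_proj {0..s} B n (R (z + (\<Sum>k=0..n-1. x k))))"
    and "y = (\<Sum>k=0..s. yc k)" and "\<forall>k\<in>{0..s}. yc k \<in> B k"
    and "z \<in> F"
    and "u = (\<Sum>k=0..s. uc k)" and "\<forall>k\<in>{0..s}. uc k \<in> U k"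
    and "xc 0 = uc 0 + S 0 (yc 0 - layer_proj {0..s} B 0 (R z) - Tstar (uc 0))"
    and "\<forall>k\<in>{1..s}. xc k =
           uc k + S k (yc k - layer_proj {0..s} B k (R (z + (\<Sum>l=0..k-1. xc l))) - Tstar (uc k))"
  shows "(\<forall>k\<in>{0..s}. xc k \<in> A k) \<and> T (z + (\<Sum>k=0..s. xc k)) = y"
proof -
  interpret VA: vector_space scaleA by fact
  interpret VB: vector_space scaleB by fact
  interpret L: Vector_Spaces.linear scaleA scaleB Tstar by fact
  define P where "P = layer_proj {0..s} B"
  \<comment> \<open>\<open>q k\<close> is the argument of \<open>R\<close> in the recursion. Layer 0
    is split off because truncated subtraction turns \<open>{0..0-1}\<close> into
    \<open>{0..0}\<close>, which would wrongly include \<open>xc 0\<close>.\<close>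
  define q where "q k = (if k = 0 then z else z + (\<Sum>l=0..k-1. xc l))" for k
  define c where "c k = yc k - P k (R (q k)) - Tstar (uc k)" for k
  note dsB = \<open>VB.direct_sum UNIV {0..s} B\<close>
  have xc: "xc k = uc k + S k (c k)" if "k \<le> s" for k
    using that assms(22,23) by (cases "k = 0") (simp_all add: c_def q_def P_def)
  have layer: "xc k \<in> A k \<and> Tstar (xc k) = yc k - P k (R (q k))" if k: "k \<le> s" for k
  proof -
    have dsA: "VA.direct_sum2 (A k) (U k) (V k)" and bij: "bij_betw Tstar (V k) (B k)"
      using hii k by auto
    have uU: "uc k \<in> U k" and yB: "yc k \<in> B k"
      using k \<open>\<forall>k\<in>{0..s}. uc k \<in> U k\<close> \<open>\<forall>k\<in>{0..s}. yc k \<in> B k\<close> by auto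
    have "Tstar (uc k) \<in> B k"
      using h1b k VA.direct_sum2_left_mem[OF dsA uU] by force
    moreover have "P k (R (q k)) \<in> B k"
      using VB.direct_sum_layer_proj(1)[OF dsB] k by (simp add: P_def)
    moreover have "VB.subspace (B k)"
      using VB.direct_sum_subspace[OF dsB] k by simp
    \<comment> \<open>\<open>S k\<close> is specified only on \<open>B k\<close>, so its argument
      must be placed there before the inverse can be used.\<close>
    ultimately have cB: "c k \<in> B k"
      using yB by (simp add: c_def VB.subspace_diff)
    then have S: "S k (c k) = the_inv_into (V k) Tstar (c k)"
      using hiii k by simp
    have "S k (c k) \<in> V k"
      using bij_betw_the_inv_into[OF bij] cB unfolding S by (rule bij_betwE[rule_format])
    moreover have "Tstar (S k (c k)) = c k"
      unfolding S by (rule f_the_inv_into_f_bij_betw[OF bij]) (use cB in simp)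
    \<comment> \<open>By linearity \<open>Tstar (xc k) = Tstar (uc k) + c k\<close>, and the term
      \<open>Tstar (uc k)\<close> subtracted in \<open>c k\<close> cancels.\<close>
    ultimately show ?thesis
      using VA.direct_sum2_add_mem[OF dsA uU] xc[OF k] by (simp add: L.add c_def)
  qed
  define x where "x = z + (\<Sum>k=0..s. xc k)"
  have xcA: "\<forall>k\<in>{0..s}. xc k \<in> A k" using layer by simp
  \<comment> \<open>Here (iv) is applied to the family \<open>xc\<close> itself, which is legitimate
    only now that each \<open>xc k\<close> is known to lie in \<open>A k\<close>.\<close>
  have PR: "P k (R x) = P k (R (q k))" if "k \<le> s" for k
    using hiv[rule_format, OF \<open>z \<in> F\<close>, of xc] xcA that
    by (cases "k = 0") (auto simp: P_def q_def x_def)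
  have "Tstar z = 0" using hi \<open>z \<in> F\<close> by blast
  then have "Tstar x = (\<Sum>k=0..s. Tstar (xc k))"
    by (simp add: x_def L.add L.sum)
  also have "\<dots> = (\<Sum>k=0..s. yc k - P k (R x))"
    by (rule sum.cong) (use layer PR in auto)
  \<comment> \<open>After \<open>PR\<close> all layers project the same vector \<open>R x\<close>,
    so the projections add up to it.\<close>
  also have "\<dots> = y - R x"
    using VB.direct_sum_layer_proj(2)[OF dsB, of "R x"]
    by (simp add: sum_subtractf P_def \<open>y = (\<Sum>k=0..s. yc k)\<close>)
  finally have "T x = y" by (simp add: decomposition)
  then show ?thesis using xcA by (simp add: x_def)
qed

end
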